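(* Average-energy games are determined and both players have memoryless optimal strategies: for every game $G=(S_1,S_2,E,w)$ and initial state $s_{init}$ there exist a value $v\in\mathbb{R}\cup\{-\infty,+\infty\}$, a memoryless strategy $\sigma_1$ of player 1 and a memoryless strategy $\sigma_2$ of player 2 such that every play from $s_{init}$ consistent with $\sigma_1$ has $\overline{\mathrm{AE}}(\pi)\le v$ and every play from $s_{init}$ consistent with $\sigma_2$ has $\overline{\mathrm{AE}}(\pi)\ge v$. In particular, for every $t\in\mathbb{Q}$, either player 1 has a memoryless winning strategy for $\mathrm{AvgEnergy}(t)$ from $s_{init}$ or player 2 has a memoryless winning strategy (against $\mathrm{AvgEnergy}(t)$) from $s_{init}$. The same holds with $\underline{\mathrm{AE}}$ in place of $\overline{\mathrm{AE}}$.
   Context: A game is a tuple $G=(S_1,S_2,E,w)$ where $S_1,S_2$ are disjoint finite sets of states (belonging to player 1 and player 2 respectively), $S=S_1\uplus S_2$, $E\subseteq S\times S$ is a set of edges such that every $s\in S$ has at least one $s'$ with $(s,s')\in E$, and $w\colon E\to\mathbb{Z}$ is a weight function. A play from $s_{init}$ is an infinite sequence $\pi=s_0s_1\dots$ with $s_0=s_{init}$ and $(s_i,s_{i+1})\in E$; $\pi(n)=s_0\dots s_n$. Energy level $\mathrm{EL}(\pi(n))=\sum_{i=0}^{n-1}w(s_i,s_{i+1})$; average-energy $\overline{\mathrm{AE}}(\pi)=\limsup_{n\to\infty}\frac1n\sum_{i=1}^{n}\mathrm{EL}(\pi(i))$, and $\underline{\mathrm{AE}}$ is defined with $\liminf$.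 A strategy of player $i$ maps each finite prefix whose last state is in $S_i$ to a successor of that state; it is memoryless if its choice depends only on the last state. A play is consistent with a strategy if the strategy's owner always moves as prescribed. Player 1 (the minimizer) wins from $s_{init}$ for an objective $\mathcal{W}$ with a strategy if all consistent plays from $s_{init}$ lie in $\mathcal{W}$; player 2 wins with a strategy if no consistent play from $s_{init}$ lies in $\mathcal{W}$. $\mathrm{AvgEnergy}(t)=\{\pi\mid\overline{\mathrm{AE}}(\pi)\le t\}$. *)

theory Defs
  imports "HOL-Library.Extended_Real"
begin

datatype player = Player1 | Player2

text \<open>The weight function is total on pairs of states; only its values on edges matter.\<close>

record 'a game =
  states1 :: "'a set"
  states2 :: "'a set"
  edges :: "('a \<times> 'a) set"
  weight :: "'a \<times> 'a \<Rightarrow> int"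

definition states :: "'a game \<Rightarrow> 'a set" where
  "states G = states1 G \<union> states2 G"

fun owned :: "'a game \<Rightarrow> player \<Rightarrow> 'a set" where
  "owned G Player1 = states1 G"
| "owned G Player2 = states2 G"

definition is_game :: "'a game \<Rightarrow> bool" where
  "is_game G \<longleftrightarrow>
     finite (states1 G) \<and> finite (states2 G) \<and> states1 G \<inter> states2 G = {} \<and>
     edges G \<subseteq> states G \<times> states G \<and>
     (\<forall>s\<in>states G. \<exists>s'. (s, s') \<in> edges G)"

definition plays_from :: "'a game \<Rightarrow> 'a \<Rightarrow> (nat \<Rightarrow> 'a) set" where
  "plays_from G s = {\<pi>. \<pi> 0 = s \<and> (\<forall>i. (\<pi> i, \<pi> (Suc i)) \<in> edges G)}"

definition plays :: "'a game \<Rightarrow> (nat \<Rightarrow> 'a) set" where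
  "plays G = (\<Union>s\<in>states G. plays_from G s)"

text \<open>The prefix up to index n has n + 1 states, the last one being the state at index n.\<close>

definition play_prefix :: "(nat \<Rightarrow> 'a) \<Rightarrow> nat \<Rightarrow> 'a list" where
  "play_prefix \<pi> n = map \<pi> [0..<Suc n]"

definition prefixes :: "'a game \<Rightarrow> player \<Rightarrow> 'a list set" where
  "prefixes G p =
     {\<rho>. \<exists>\<pi>\<in>plays G. \<exists>n. \<rho> = play_prefix \<pi> n \<and> last \<rho> \<in> owned G p}"

definition is_strategy :: "'a game \<Rightarrow> player \<Rightarrow> ('a list \<Rightarrow> 'a) \<Rightarrow> bool" where
  "is_strategy G p \<sigma> \<longleftrightarrow> (\<forall>\<rho>\<in>prefixes G p. (last \<rho>, \<sigma> \<rho>) \<in> edges G)"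

definition memoryless :: "'a game \<Rightarrow> player \<Rightarrow> ('a list \<Rightarrow> 'a) \<Rightarrow> bool" where
  "memoryless G p \<sigma> \<longleftrightarrow>
     (\<forall>\<rho>\<in>prefixes G p. \<forall>\<rho>'\<in>prefixes G p. last \<rho> = last \<rho>' \<longrightarrow> \<sigma> \<rho> = \<sigma> \<rho>')"

definition memoryless_strategy :: "'a game \<Rightarrow> player \<Rightarrow> ('a list \<Rightarrow> 'a) \<Rightarrow> bool" where
  "memoryless_strategy G p \<sigma> \<longleftrightarrow> is_strategy G p \<sigma> \<and> memoryless G p \<sigma>"

definition consistent_plays ::
    "'a game \<Rightarrow> 'a \<Rightarrow> player \<Rightarrow> ('a list \<Rightarrow> 'a) \<Rightarrow> (nat \<Rightarrow> 'a) set" where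
  "consistent_plays G s p \<sigma> =
     {\<pi>\<in>plays_from G s. \<forall>n. \<pi> n \<in> owned G p \<longrightarrow> \<pi> (Suc n) = \<sigma> (play_prefix \<pi> n)}"

definition energy_level :: "'a game \<Rightarrow> (nat \<Rightarrow> 'a) \<Rightarrow> nat \<Rightarrow> int" where
  "energy_level G \<pi> n = (\<Sum>i<n. weight G (\<pi> i, \<pi> (Suc i)))"

text \<open>At index 0 the mean below is 0 by the convention on division, which affects neither limit.\<close>

definition mean_energy :: "'a game \<Rightarrow> (nat \<Rightarrow> 'a) \<Rightarrow> nat \<Rightarrow> real" where
  "mean_energy G \<pi> n = 1 / real n * (\<Sum>i = 1..n. real_of_int (energy_level G \<pi> i))"

definition AE_sup :: "'a game \<Rightarrow> (nat \<Rightarrow> 'a) \<Rightarrow> ereal" where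
  "AE_sup G \<pi> = limsup (\<lambda>n. ereal (mean_energy G \<pi> n))"

definition AE_inf :: "'a game \<Rightarrow> (nat \<Rightarrow> 'a) \<Rightarrow> ereal" where
  "AE_inf G \<pi> = liminf (\<lambda>n. ereal (mean_energy G \<pi> n))"

definition AvgEnergy_sup :: "'a game \<Rightarrow> rat \<Rightarrow> (nat \<Rightarrow> 'a) set" where
  "AvgEnergy_sup G t = {\<pi>\<in>plays G. AE_sup G \<pi> \<le> ereal (of_rat t)}"

definition AvgEnergy_inf :: "'a game \<Rightarrow> rat \<Rightarrow> (nat \<Rightarrow> 'a) set" where
  "AvgEnergy_inf G t = {\<pi>\<in>plays G. AE_inf G \<pi> \<le> ereal (of_rat t)}"

text \<open>Objectives are always those of player 1: player 2 wins by avoiding the objective.\<close>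

fun wins_with ::
    "'a game \<Rightarrow> 'a \<Rightarrow> player \<Rightarrow> ('a list \<Rightarrow> 'a) \<Rightarrow> (nat \<Rightarrow> 'a) set \<Rightarrow> bool" where
  "wins_with G s Player1 \<sigma> W \<longleftrightarrow> (\<forall>\<pi>\<in>consistent_plays G s Player1 \<sigma>. \<pi> \<in> W)"
| "wins_with G s Player2 \<sigma> W \<longleftrightarrow> (\<forall>\<pi>\<in>consistent_plays G s Player2 \<sigma>. \<pi> \<notin> W)"

end

theory Submission
  imports Defs "HOL-Library.FuncSet"
begin

text \<open>Discounted games with factor 1 - \<epsilon> have memoryless optimal strategies, and as there are
  finitely many of these, one choice f of successors is optimal for arbitrarily small
  \<epsilon>. Since f is a map on a finite set, the discounted values expand as
  g s / \<epsilon> + h s + \<epsilon> * k s up to an error of order \<epsilon>^2,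
  so the optimality inequalities along the edges turn into lexicographic inequalities for
  (g, h, k). Here g is the mean payoff; where it is 0, h is the average-energy
  value, and k serves as a potential for the averages of h. Abel limits alone
  would not suffice, as they do not control the limit superior of the Cesaro means.\<close>

section \<open>Elementary bounds on finite sets and on partial sums\<close>

text \<open>The largest of the finitely many ratios \<open>x a / y a\<close> serves as
  \<open>D\<close>; where \<open>y\<close> vanishes, the hypothesis on \<open>x\<close> takes over.
  This turns an inequality known only at zero slack into one with a penalty linear in the slack.
  With 1 in place of \<open>y\<close> it merely bounds a function.\<close>

lemma finite_domination:
  fixes x y :: "'a \<Rightarrow> real"
  assumes "finite A" "\<And>a. a \<in> A \<Longrightarrow> 0 \<le> y a" "\<And>a. a \<in> A \<Longrightarrow> y a = 0 \<Longrightarrow> x a \<le> 0"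
  shows "\<exists>D\<ge>0. \<forall>a\<in>A. x a \<le> D * y a"
  using assms
proof (induction A rule: finite_induct)
  case empty
  then show ?case by auto
next
  case (insert a A)
  then obtain D where D: "D \<ge> 0" "\<forall>a\<in>A. x a \<le> D * y a" by auto
  define D' where "D' = max D (x a / y a)"
  have "x a \<le> D' * y a"
  proof (cases "y a = 0")
    case True
    then show ?thesis using insert.prems by simp
  next
    case False
    then have "y a > 0" using insert.prems(1)[of a] by simp
    then have "x a = x a / y a * y a" by simp
    also have "\<dots> \<le> D' * y a"
      using \<open>y a > 0\<close> by (intro mult_right_mono) (auto simp: D'_def)
    finally show ?thesis .
  qed
  moreover have "x b \<le> D' * y b" if "b \<in> A" for b
  proof -
    have "x b \<le> D * y b" using D that by auto
    also have "\<dots> \<le> D' * y b"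
      using insert.prems(1)[of b] that by (intro mult_right_mono) (auto simp: D'_def)
    finally show ?thesis .
  qed
  moreover have "D' \<ge> 0" using D by (auto simp: D'_def)
  ultimately show ?case by auto
qed

text \<open>While \<open>Z\<close> stays below \<open>D * M\<close> the product is bounded. From
  there on, each step adds at least \<open>D * M\<close> to the sum and at most \<open>D * M\<close>
  to the product.\<close>

lemma mult_minus_sum_bounded:
  fixes Z :: "nat \<Rightarrow> real"
  assumes Z0: "Z 0 = 0" and inc: "\<And>n. Z n \<le> Z (Suc n)" and M: "\<And>n. Z (Suc n) - Z n \<le> M"
    and D: "D \<ge> 0"
  shows "D * Z n - (\<Sum>i=1..n. Z i) \<le> D * (D * M)"
proof -
  have nonneg: "Z n \<ge> 0" for n
    using lift_Suc_mono_le[of Z 0 n] inc Z0 by auto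
  have "M \<ge> 0" using inc[of 0] M[of 0] by simp
  show ?thesis
  proof (induction n)
    case 0
    then show ?case using Z0 D \<open>M \<ge> 0\<close> by simp
  next
    case (Suc n)
    show ?case
    proof (cases "Z (Suc n) \<ge> D * M")
      case True
      have "D * (Z (Suc n) - Z n) \<le> D * M" using M D by (intro mult_left_mono) auto
      then show ?thesis using Suc True by (simp add: algebra_simps)
    next
      case False
      then have "D * Z (Suc n) \<le> D * (D * M)" using D by (intro mult_left_mono) auto
      moreover have "(\<Sum>i=1..Suc n. Z i) \<ge> 0" using nonneg by (intro sum_nonneg) auto
      ultimately show ?thesis by linarith
    qed
  qed
qed

section \<open>Lexicographic inequalities along a play\<close>

text \<open>The clauses compare the coefficients of \<open>1 / \<epsilon>\<close>, 1 and
  \<open>\<epsilon>\<close> in \<open>c + (1 - \<epsilon>) * v t \<le> v s\<close> for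
  \<open>v = g / \<epsilon> + h + \<epsilon> * k\<close>; each counts only if the earlier ones
  tie.\<close>

definition lex_step :: "('a \<Rightarrow> real) \<Rightarrow> ('a \<Rightarrow> real) \<Rightarrow> ('a \<Rightarrow> real) \<Rightarrow> real \<Rightarrow> 'a \<Rightarrow> 'a \<Rightarrow> bool" where
  "lex_step g h k c s t \<longleftrightarrow>
     g t \<le> g s \<and>
     (g t = g s \<longrightarrow> c - g s + h t \<le> h s) \<and>
     (g t = g s \<and> c - g s + h t = h s \<longrightarrow> k t - h t \<le> k s)"

text \<open>All slack of the lexicographic inequalities is collected in the nonnegative
  quantity r below, after absorbing the drops of g into h. A step without
  slack obeys the inequality for k, and accumulated slack pays for the
  violations of that inequality because it enters the sum of the energy levels once per
  subsequent index.\<close>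

lemma lex_step_sum_bound:
  fixes g h k :: "'a \<Rightarrow> real" and c :: "'a \<Rightarrow> 'a \<Rightarrow> real" and \<pi> :: "nat \<Rightarrow> 'a"
  assumes "finite E"
    and lex: "\<And>s t. (s, t) \<in> E \<Longrightarrow> lex_step g h k (c s t) s t"
    and \<pi>: "\<And>i. (\<pi> i, \<pi> (Suc i)) \<in> E"
  shows "\<exists>C. \<forall>n. (\<Sum>i=1..n. \<Sum>j<i. c (\<pi> j) (\<pi> (Suc j)))
               \<le> g (\<pi> 0) * (\<Sum>i=1..n. real i) + real n * h (\<pi> 0) + C"
proof -
  define G0 where "G0 = g (\<pi> 0)"
  \<comment> \<open>Since \<open>g\<close> never rises along the play, the play stays in
    \<open>A\<close>. Below, \<open>x\<close> subtracts \<open>G0\<close> rather than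
    \<open>g s\<close>, and \<open>g s \<le> G0\<close> then yields \<open>x \<le> 0\<close> on the
    edges that keep \<open>g\<close>.\<close>
  define A where "A = {(s, t) \<in> E. g s \<le> G0}"
  have finA: "finite A" using \<open>finite E\<close> by (rule finite_subset[rotated]) (auto simp: A_def)
  have lexA: "lex_step g h k (c s t) s t" "g s \<le> G0" if "(s, t) \<in> A" for s t
    using that lex by (auto simp: A_def)
  have "g (\<pi> i) \<le> G0" for i
  proof (induction i)
    case (Suc i)
    then show ?case using lex[OF \<pi>[of i]] by (auto simp: lex_step_def)
  qed (simp add: G0_def)
  then have \<pi>A: "(\<pi> i, \<pi> (Suc i)) \<in> A" for i using \<pi> by (auto simp: A_def)
  define x where "x = (\<lambda>(s, t). c s t - G0 + h t - h s)"
  have "\<exists>D\<ge>0. \<forall>e\<in>A. x e \<le> D * (\<lambda>(s, t). g s - g t) e"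
    by (rule finite_domination[OF finA]) (use lexA in \<open>fastforce simp: x_def lex_step_def\<close>)+
  then obtain D where D: "D \<ge> 0" and xD: "\<And>s t. (s, t) \<in> A \<Longrightarrow> x (s, t) \<le> D * (g s - g t)"
    by fastforce
  \<comment> \<open>The multiple \<open>D\<close> alone would make the slack nonnegative. The extra
    1 makes zero slack force \<open>g s = g t\<close>, whence also \<open>g s = G0\<close>, and
    there \<open>h'\<close> coincides with \<open>h\<close>.\<close>
  define h' where "h' s = h s + (D + 1) * (g s - G0)" for s
  define r where "r = (\<lambda>(s, t). h' s - h' t - (c s t - G0))"
  have r_eq: "r (s, t) = (g s - g t) + (D * (g s - g t) - x (s, t))" for s t
    by (simp add: r_def h'_def x_def algebra_simps)
  have r_nonneg: "r (s, t) \<ge> 0" if "(s, t) \<in> A" for s t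
    using xD[OF that] lexA[OF that] by (simp add: r_eq lex_step_def)
  have r_zero: "k t - k s - h' t \<le> 0" if "(s, t) \<in> A" "r (s, t) = 0" for s t
  proof -
    have "g t \<le> g s" using lexA(1)[OF that(1)] by (simp add: lex_step_def)
    then have g: "g s = g t" using xD[OF that(1)] that(2) unfolding r_eq by linarith
    then have x0: "x (s, t) = 0" using that(2) by (simp add: r_eq)
    then have "g s = G0" "c s t - g s + h t = h s"
      using lexA[OF that(1)] g by (auto simp: x_def lex_step_def)
    then show ?thesis using g lexA(1)[OF that(1)] by (auto simp: lex_step_def h'_def)
  qed
  have "\<exists>D'\<ge>0. \<forall>e\<in>A. (\<lambda>(s, t). k t - k s - h' t) e \<le> D' * r e"
    by (rule finite_domination[OF finA]) (use r_nonneg r_zero in fastforce)+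
  then obtain D' where D': "D' \<ge> 0"
    and kD': "\<And>s t. (s, t) \<in> A \<Longrightarrow> k t - k s - h' t \<le> D' * r (s, t)"
    by fastforce
  have "\<exists>M\<ge>0. \<forall>e\<in>A. r e \<le> M * 1"
    by (rule finite_domination[OF finA]) auto
  then obtain M where M: "\<And>e. e \<in> A \<Longrightarrow> r e \<le> M" by auto
  have "\<exists>K\<ge>0. \<forall>e\<in>A. - k (fst e) \<le> K * 1"
    by (rule finite_domination[OF finA]) auto
  then obtain K where K: "\<And>s t. (s, t) \<in> A \<Longrightarrow> - k s \<le> K" by fastforce
  define Z where "Z n = (\<Sum>j<n. r (\<pi> j, \<pi> (Suc j)))" for n
  have Zbound: "D' * Z n - (\<Sum>i=1..n. Z i) \<le> D' * (D' * M)" for n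
    by (rule mult_minus_sum_bounded) (use \<pi>A M D' r_nonneg in \<open>auto simp: Z_def\<close>)
  \<comment> \<open>The weights are \<open>G0 + h' s - h' t - r (s, t)\<close>, which telescopes;
    \<open>h'\<close> and \<open>h\<close> agree at the start because \<open>g (\<pi> 0)\<close> is
    \<open>G0\<close>.\<close>
  have EL: "(\<Sum>j<i. c (\<pi> j) (\<pi> (Suc j))) = real i * G0 + h (\<pi> 0) - h' (\<pi> i) - Z i" for i
    by (induction i) (auto simp: Z_def r_def h'_def G0_def algebra_simps)
  have Hsum: "(\<Sum>i=1..n. - h' (\<pi> i)) \<le> k (\<pi> 0) - k (\<pi> n) + D' * Z n" for n
  proof (induction n)
    case (Suc n)
    then show ?case using kD'[OF \<pi>A[of n]] by (simp add: Z_def algebra_simps)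
  qed (simp add: Z_def)
  have "(\<Sum>i=1..n. \<Sum>j<i. c (\<pi> j) (\<pi> (Suc j)))
      \<le> G0 * (\<Sum>i=1..n. real i) + real n * h (\<pi> 0) + (k (\<pi> 0) + K + D' * (D' * M))" for n
  proof -
    have "(\<Sum>i=1..n. \<Sum>j<i. c (\<pi> j) (\<pi> (Suc j)))
        = G0 * (\<Sum>i=1..n. real i) + real n * h (\<pi> 0) + (\<Sum>i=1..n. - h' (\<pi> i)) - (\<Sum>i=1..n. Z i)"
      by (simp add: EL sum.distrib sum_subtractf sum_negf sum_distrib_left mult.commute)
    also have "\<dots> \<le> G0 * (\<Sum>i=1..n. real i) + real n * h (\<pi> 0) + (k (\<pi> 0) + K + D' * (D' * M))"
      using Hsum[of n] Zbound[of n] K[OF \<pi>A[of n]] by linarith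
    finally show ?thesis .
  qed
  then show ?thesis by (auto simp: G0_def)
qed

text \<open>After division by \<open>n\<close> the bound on the sums reads
  \<open>h + g * (n + 1) / 2 + C / n\<close>, so a negative \<open>g\<close> drives it to minus
  infinity. For positive \<open>g\<close> the claim is trivial.\<close>

lemma lex_step_limsup:
  fixes g h k :: "'a \<Rightarrow> real" and c :: "'a \<Rightarrow> 'a \<Rightarrow> real" and \<pi> :: "nat \<Rightarrow> 'a"
  assumes "finite E"
    and "\<And>s t. (s, t) \<in> E \<Longrightarrow> lex_step g h k (c s t) s t"
    and "\<And>i. (\<pi> i, \<pi> (Suc i)) \<in> E"
  shows "limsup (\<lambda>n. ereal (1 / real n * (\<Sum>i=1..n. \<Sum>j<i. c (\<pi> j) (\<pi> (Suc j)))))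
       \<le> (if g (\<pi> 0) = 0 then ereal (h (\<pi> 0)) else if g (\<pi> 0) < 0 then -\<infinity> else \<infinity>)"
    (is "limsup (\<lambda>n. ereal (?m n)) \<le> ?v")
proof (cases "g (\<pi> 0) > 0")
  case False
  obtain C where C: "\<And>n. (\<Sum>i=1..n. \<Sum>j<i. c (\<pi> j) (\<pi> (Suc j)))
               \<le> g (\<pi> 0) * (\<Sum>i=1..n. real i) + real n * h (\<pi> 0) + C"
    using lex_step_sum_bound[of E g h k c \<pi>, OF assms] by auto
  define b where "b n = h (\<pi> 0) + g (\<pi> 0) * ((real n + 1) / 2) + C / real n" for n
  have gauss: "(\<Sum>i=1..n. real i) = real n * ((real n + 1) / 2)" for n
    by (induction n) (auto simp: field_simps)
  have "?m n \<le> b n" if "n \<ge> 1" for n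
  proof -
    have "?m n \<le> 1 / real n * (g (\<pi> 0) * (\<Sum>i=1..n. real i) + real n * h (\<pi> 0) + C)"
      by (intro mult_left_mono C) auto
    also have "\<dots> = b n" unfolding gauss b_def using that by (simp add: field_simps)
    finally show ?thesis .
  qed
  then have "\<forall>\<^sub>F n in sequentially. ereal (?m n) \<le> ereal (b n)"
    unfolding eventually_sequentially ereal_less_eq by blast
  then have "limsup (\<lambda>n. ereal (?m n)) \<le> limsup (\<lambda>n. ereal (b n))"
    by (rule Limsup_mono)
  also have "\<dots> = ?v"
  proof (rule lim_imp_Limsup)
    show "((\<lambda>n. ereal (b n)) \<longlongrightarrow> ?v) sequentially"
    proof (cases "g (\<pi> 0) = 0")
      case True
      have "b \<longlonglongrightarrow> h (\<pi> 0)" unfolding b_def True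
        using tendsto_add[OF tendsto_const lim_const_over_n[of C]] by simp
      then show ?thesis using True by simp
    next
      case neg: False
      with False have "g (\<pi> 0) < 0" by simp
      \<comment> \<open>The half in \<open>(n + 1) / 2\<close> joins the convergent part, which
        leaves a purely linear term.\<close>
      have "((\<lambda>n. h (\<pi> 0) + g (\<pi> 0) / 2 + C / real n) \<longlongrightarrow> h (\<pi> 0) + g (\<pi> 0) / 2 + 0) sequentially"
        by (intro tendsto_intros lim_const_over_n)
      moreover have "filterlim (\<lambda>n. g (\<pi> 0) / 2 * real n) at_bot sequentially"
        using \<open>g (\<pi> 0) < 0\<close>
        by (intro filterlim_tendsto_neg_mult_at_bot[OF tendsto_const] filterlim_real_sequentially) auto
      ultimately have "filterlim (\<lambda>n. (h (\<pi> 0) + g (\<pi> 0) / 2 + C / real n) + g (\<pi> 0) / 2 * real n)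
          at_bot sequentially"
        by (simp only: filterlim_tendsto_add_at_bot_iff)
      moreover have "b = (\<lambda>n. (h (\<pi> 0) + g (\<pi> 0) / 2 + C / real n) + g (\<pi> 0) / 2 * real n)"
        by (simp add: b_def fun_eq_iff field_simps)
      ultimately have "filterlim b at_bot sequentially" by simp
      then show ?thesis using neg \<open>g (\<pi> 0) < 0\<close> 
        by (simp add: tendsto_MInfty filterlim_at_bot_dense)
    qed
  qed simp
  finally show ?thesis .
qed simp

section \<open>Discounted games\<close>

text \<open>Real-valued functions form no complete lattice. However, the constant \<open>B\<close>
  lies in \<open>P\<close> and \<open>- B\<close> bounds \<open>P\<close> from below, so its
  pointwise infimum is real and the usual argument for least fixed points goes through.\<close>

lemma knaster_tarski_real:
  fixes T :: "('a \<Rightarrow> real) \<Rightarrow> 'a \<Rightarrow> real"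
  assumes mono: "mono T" and B: "B \<ge> 0" "T (\<lambda>_. B) \<le> (\<lambda>_. B)" "(\<lambda>_. - B) \<le> T (\<lambda>_. - B)"
  shows "\<exists>u. T u = u"
proof -
  define P where "P = {u. (\<lambda>_. - B) \<le> u \<and> T u \<le> u}"
  define v where "v x = Inf ((\<lambda>u. u x) ` P)" for x
  have BP: "(\<lambda>_. B) \<in> P" using B by (auto simp: P_def le_fun_def)
  have lower: "v \<le> u" if "u \<in> P" for u
    unfolding le_fun_def v_def using that
    by (auto intro!: cINF_lower bdd_belowI[of _ "- B"] simp: P_def le_fun_def)
  have greatest: "u \<le> v" if "\<And>u'. u' \<in> P \<Longrightarrow> u \<le> u'" for u
    unfolding le_fun_def v_def using that BP by (auto intro!: cINF_greatest simp: le_fun_def)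
  have "(\<lambda>_. - B) \<le> v" by (rule greatest) (auto simp: P_def)
  have "T v \<le> v"
  proof (rule greatest)
    fix u assume "u \<in> P"
    then have "T v \<le> T u" by (intro monoD[OF mono] lower)
    also have "T u \<le> u" using \<open>u \<in> P\<close> by (simp add: P_def)
    finally show "T v \<le> u" .
  qed
  moreover have "v \<le> T v"
  proof (rule lower)
    have "(\<lambda>_. - B) \<le> T (\<lambda>_. - B)" by (rule B)
    also have "\<dots> \<le> T v" by (rule monoD[OF mono \<open>(\<lambda>_. - B) \<le> v\<close>])
    finally show "T v \<in> P" using monoD[OF mono \<open>T v \<le> v\<close>] by (simp add: P_def)
  qed
  ultimately show ?thesis by (auto intro: antisym)
qed

text \<open>\<open>v\<close> is a fixed point of Shapley's operator, obtained from monotonicity, and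
  \<open>f\<close> picks edges at which the minimum or maximum over the finitely many successors is
  attained.\<close>

lemma discounted_optimality:
  fixes G :: "'a game" and c :: "'a \<Rightarrow> 'a \<Rightarrow> real"
  assumes G: "is_game G" and \<beta>: "0 < \<beta>" "\<beta> < 1"
  shows "\<exists>v f. \<forall>s\<in>states G. (s, f s) \<in> edges G \<and> v s = c s (f s) + \<beta> * v (f s) \<and>
           (\<forall>t. (s, t) \<in> edges G \<longrightarrow>
              (s \<in> states1 G \<longrightarrow> v s \<le> c s t + \<beta> * v t) \<and>
              (s \<in> states2 G \<longrightarrow> c s t + \<beta> * v t \<le> v s))"
proof -
  define A where "A u s = (\<lambda>t. c s t + \<beta> * u t) ` (edges G `` {s})" for u s
  have fin: "finite (states G)" using G by (auto simp: is_game_def states_def)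
  have finE: "finite (edges G)"
    using G fin by (auto simp: is_game_def intro: finite_subset)
  have "finite (edges G `` {s})" for s
    using finE by (rule finite_Image)
  then have finA: "finite (A u s)" for u s by (auto simp: A_def)
  have neA: "A u s \<noteq> {}" if "s \<in> states G" for u s
    using G that by (auto simp: is_game_def A_def)
  \<comment> \<open>Outside the states there are no edges to optimise over; the default 0 lies
    between \<open>- B\<close> and \<open>B\<close> and so preserves these bounds.\<close>
  define T where "T u s = (if s \<in> states1 G then Min (A u s)
    else if s \<in> states2 G then Max (A u s) else 0)" for u s
  have st: "s \<in> states G" if "s \<in> states1 G \<or> s \<in> states2 G" for s
    using that by (auto simp: states_def)
  have le: "c s t + \<beta> * u t \<le> c s t + \<beta> * u' t" if "u \<le> u'" for u u' s t
    using that \<beta> by (auto simp: le_fun_def intro: mult_left_mono)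
  have "mono T"
  proof (rule monoI, rule le_funI)
    fix u u' :: "'a \<Rightarrow> real" and s assume u: "u \<le> u'"
    show "T u s \<le> T u' s"
    proof -
      have "Min (A u s) \<le> Min (A u' s)" if s: "s \<in> states1 G"
      proof (rule Min.boundedI[OF finA neA])
        fix x assume "x \<in> A u' s"
        then obtain t where t: "(s, t) \<in> edges G" "x = c s t + \<beta> * u' t" by (auto simp: A_def)
        then have "Min (A u s) \<le> c s t + \<beta> * u t" using finA by (auto simp: A_def)
        also have "\<dots> \<le> x" unfolding t(2) by (rule le[OF u])
        finally show "Min (A u s) \<le> x" .
      qed (use s st in auto)
      moreover have "Max (A u s) \<le> Max (A u' s)" if s: "s \<in> states2 G"
      proof (rule Max.boundedI[OF finA neA])
        fix x assume "x \<in> A u s"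
        then obtain t where t: "(s, t) \<in> edges G" "x = c s t + \<beta> * u t" by (auto simp: A_def)
        then have "x \<le> c s t + \<beta> * u' t" using le[OF u] by simp
        also have "\<dots> \<le> Max (A u' s)" using t(1) finA by (auto simp: A_def)
        finally show "x \<le> Max (A u' s)" .
      qed (use s st in auto)
      ultimately show ?thesis by (auto simp: T_def)
    qed
  qed
  have "\<exists>W\<ge>0. \<forall>e\<in>edges G. \<bar>c (fst e) (snd e)\<bar> \<le> W * 1"
    by (rule finite_domination[OF finE]) auto
  then obtain W where W: "W \<ge> 0" "\<And>s t. (s, t) \<in> edges G \<Longrightarrow> \<bar>c s t\<bar> \<le> W" by fastforce
  \<comment> \<open>This solves \<open>W + \<beta> * B = B\<close>, so \<open>T\<close> maps the
    constant \<open>B\<close> below itself and the constant \<open>- B\<close> above itself.\<close>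
  define B where "B = W / (1 - \<beta>)"
  have B: "B \<ge> 0" "W + \<beta> * B = B" using W(1) \<beta> by (auto simp: B_def field_simps)
  have upper: "a \<le> B" if "a \<in> A (\<lambda>_. B) s" for a s
    using that W(2) B(2) by (fastforce simp: A_def)
  have lower: "- B \<le> a" if "a \<in> A (\<lambda>_. - B) s" for a s
    using that W(2) B(2) by (fastforce simp: A_def)
  have "T (\<lambda>_. B) s \<le> B" for s
    unfolding T_def
    using upper[OF Min_in[OF finA neA]] upper[OF Max_in[OF finA neA]] st B(1) by auto
  moreover have "- B \<le> T (\<lambda>_. - B) s" for s
    unfolding T_def
    using lower[OF Min_in[OF finA neA]] lower[OF Max_in[OF finA neA]] st B(1) by auto
  ultimately obtain v where v: "T v = v"
    using knaster_tarski_real[OF \<open>mono T\<close> B(1)] by (auto simp: le_fun_def)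
  have "\<exists>t. (s, t) \<in> edges G \<and> v s = c s t + \<beta> * v t \<and>
      (\<forall>t. (s, t) \<in> edges G \<longrightarrow>
              (s \<in> states1 G \<longrightarrow> v s \<le> c s t + \<beta> * v t) \<and>
              (s \<in> states2 G \<longrightarrow> c s t + \<beta> * v t \<le> v s))" if s: "s \<in> states G" for s
  proof -
    have mem: "c s t + \<beta> * v t \<in> A v s" if "(s, t) \<in> edges G" for t
      using that by (auto simp: A_def)
    have disj: "s \<in> states1 G \<Longrightarrow> s \<notin> states2 G" using G by (auto simp: is_game_def)
    have vs: "v s = T v s" using v by simp
    have "v s \<in> A v s"
      unfolding vs T_def using s Min_in[OF finA neA] Max_in[OF finA neA] by (auto simp: states_def)
    moreover have "v s \<le> a" if "s \<in> states1 G" "a \<in> A v s" for a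
      using that finA vs by (auto simp: T_def)
    moreover have "a \<le> v s" if "s \<in> states2 G" "a \<in> A v s" for a
      using that finA vs disj by (auto simp: T_def)
    ultimately show ?thesis using mem by (auto simp: A_def)
  qed
  then show ?thesis by metis
qed

section \<open>Expansion of discounted values for a fixed choice of successors\<close>

text \<open>The pigeonhole principle is applied to whole iterates, restricted to \<open>S\<close> so
  that they range over a finite set. Thus one preperiod and one period serve all points.\<close>

lemma funpow_eventually_periodic:
  assumes "finite S" "f ` S \<subseteq> S"
  shows "\<exists>a p. p > 0 \<and> (\<forall>s\<in>S. (f ^^ (a + p)) s = (f ^^ a) s)"
proof -
  have in_S: "(f ^^ n) s \<in> S" if "s \<in> S" for n s
    by (induction n) (use assms(2) that in auto)
  have "range (\<lambda>n. restrict (f ^^ n) S) \<subseteq> S \<rightarrow>\<^sub>E S" using in_S by auto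
  then have "finite (range (\<lambda>n. restrict (f ^^ n) S))"
    by (rule finite_subset) (auto intro: finite_PiE assms(1))
  then have "\<not> inj (\<lambda>n::nat. restrict (f ^^ n) S)"
    using finite_imageD infinite_UNIV_nat by blast
  then obtain a b where ab: "a < b" "restrict (f ^^ a) S = restrict (f ^^ b) S"
    unfolding inj_def by (metis linorder_neqE_nat)
  have "(f ^^ (a + (b - a))) s = (f ^^ a) s" if "s \<in> S" for s
    using fun_cong[OF ab(2), of s] that ab(1) by simp
  then show ?thesis using ab(1) by (intro exI[of _ a] exI[of _ "b - a"]) auto
qed

text \<open>\<open>g\<close> is the mean of \<open>c\<close> over a period after the preperiod
  \<open>a\<close>. The solution \<open>h\<close> sums the centred costs \<open>d\<close> over the
  preperiod and adds a solution \<open>q\<close> for the periodic part.\<close>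

lemma poisson_equation:
  fixes c :: "'a \<Rightarrow> real"
  assumes "finite S" "f ` S \<subseteq> S"
  shows "\<exists>g h. \<forall>s\<in>S. g (f s) = g s \<and> h s = c s - g s + h (f s)"
proof -
  obtain a p where p: "p > 0" and per: "\<And>s. s \<in> S \<Longrightarrow> (f ^^ (a + p)) s = (f ^^ a) s"
    using funpow_eventually_periodic[OF assms] by auto
  define g where "g s = (\<Sum>i<p. c ((f ^^ (a + i)) s)) / real p" for s
  \<comment> \<open>A window moved by one step loses its first term and gains the term just after
    its end; over a full period past the preperiod these agree.\<close>
  have shift: "(\<Sum>i<n. F ((f ^^ (b + i)) (f s))) =
      (\<Sum>i<n. F ((f ^^ (b + i)) s)) + F ((f ^^ (b + n)) s) - F ((f ^^ b) s)" for F :: "'a \<Rightarrow> real" and b n s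
    by (induction n) (auto simp: funpow_swap1)
  have g_inv: "g (f s) = g s" if "s \<in> S" for s
    unfolding g_def shift by (simp add: per[OF that])
  have g_inv': "(f ^^ n) s \<in> S \<and> g ((f ^^ n) s) = g s" if "s \<in> S" for n s
    by (induction n) (use that g_inv assms(2) in auto)
  define d where "d s = c s - g s" for s
  have d0: "(\<Sum>i<p. d ((f ^^ (a + i)) s)) = 0" if "s \<in> S" for s
  proof -
    have "(\<Sum>i<p. d ((f ^^ (a + i)) s)) = (\<Sum>i<p. c ((f ^^ (a + i)) s)) - real p * g s"
      using g_inv'[OF that] by (simp add: d_def sum_subtractf)
    moreover have "real p * g s = (\<Sum>i<p. c ((f ^^ (a + i)) s))" using p by (simp add: g_def)
    ultimately show ?thesis by linarith
  qed
  \<comment> \<open>This is the mean of the partial sums of \<open>d\<close> of lengths 1 to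
    \<open>p\<close>. Starting one step later loses \<open>d ((f ^^ a) s)\<close> from each;
    otherwise the lengths 1 to \<open>p\<close> become 2 to \<open>p + 1\<close>, which have the
    same mean since a full period sums to 0.\<close>
  define q where "q s = (\<Sum>i<p. (real p - real i) * d ((f ^^ (a + i)) s)) / real p" for s
  \<comment> \<open>The weights use \<open>m\<close> and not \<open>n\<close>, so that they stay
    fixed in the induction; both become \<open>p\<close> afterwards.\<close>
  have weighted: "(\<Sum>i<n. (real m - real i) * d ((f ^^ (a + i)) (f s))) =
      (\<Sum>i<n. (real m - real i) * d ((f ^^ (a + i)) s)) + (\<Sum>i<n. d ((f ^^ (a + i)) s))
      + (real m + 1 - real n) * d ((f ^^ (a + n)) s) - (real m + 1) * d ((f ^^ a) s)" for n m s
    by (induction n) (auto simp: funpow_swap1 algebra_simps)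
  have q: "q (f s) = q s - d ((f ^^ a) s)" if "s \<in> S" for s
    unfolding q_def weighted d0[OF that] per[OF that] using p
    by (simp add: add_divide_distrib diff_divide_distrib distrib_right left_diff_distrib)
  \<comment> \<open>The form \<open>0 + i\<close> lets \<open>shift\<close> apply with
    \<open>b\<close> equal to 0.\<close>
  define h where "h s = (\<Sum>i<a. d ((f ^^ (0 + i)) s)) + q s" for s
  have "h (f s) = h s - d s" if "s \<in> S" for s
    unfolding h_def shift q[OF that] by simp
  then show ?thesis using g_inv by (intro exI[of _ g] exI[of _ h]) (auto simp: d_def)
qed

text \<open>Comparing powers of \<open>\<epsilon>\<close> in the discounted equation gives a chain
  of Poisson equations. Their solutions depend only on \<open>c\<close> and \<open>f\<close>, so
  \<open>g\<close>, \<open>h\<close>, \<open>k\<close> and \<open>L\<close> are chosen before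
  \<open>\<epsilon>\<close> and \<open>v\<close>.\<close>

lemma discounted_expansion:
  fixes c :: "'a \<Rightarrow> real"
  assumes "finite S" "f ` S \<subseteq> S"
  shows "\<exists>g h k L. \<forall>\<epsilon> v. 0 < \<epsilon> \<longrightarrow> \<epsilon> < 1 \<longrightarrow>
           (\<forall>s\<in>S. v s = c s + (1 - \<epsilon>) * v (f s)) \<longrightarrow>
           (\<forall>s\<in>S. \<bar>v s - (g s / \<epsilon> + h s + \<epsilon> * k s)\<bar> \<le> L * \<epsilon>\<^sup>2)"
proof -
  have fS: "f s \<in> S" if "s \<in> S" for s using assms(2) that by auto
  obtain g h0 where g: "\<And>s. s \<in> S \<Longrightarrow> g (f s) = g s"
    and h0: "\<And>s. s \<in> S \<Longrightarrow> h0 s = c s - g s + h0 (f s)"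
    using poisson_equation[OF assms, of c] by auto
  obtain g1 k0 where g1: "\<And>s. s \<in> S \<Longrightarrow> g1 (f s) = g1 s"
    and k0: "\<And>s. s \<in> S \<Longrightarrow> k0 s = - h0 (f s) - g1 s + k0 (f s)"
    using poisson_equation[OF assms, of "\<lambda>s. - h0 (f s)"] by auto
  define h where "h s = h0 s + g1 s" for s
  \<comment> \<open>Adding an f-invariant function to h0 keeps its equation and removes the obstruction
    g1 to solving the next one. The extra term l gives an error of order
    \<epsilon>^2 rather than \<epsilon>.\<close>
  obtain g2 l where g2: "\<And>s. s \<in> S \<Longrightarrow> g2 (f s) = g2 s"
    and l: "\<And>s. s \<in> S \<Longrightarrow> l s = - k0 (f s) - g2 s + l (f s)"
    using poisson_equation[OF assms, of "\<lambda>s. - k0 (f s)"] by auto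
  define k where "k s = k0 s + g2 s" for s
  have h: "h (f s) = h s - c s + g s" if "s \<in> S" for s
    using that h0[of s] g1[of s] by (simp add: h_def)
  have k: "k (f s) = k s + h (f s)" if "s \<in> S" for s
    using that k0[of s] g1[of s] g2[of s] by (simp add: h_def k_def)
  have l: "l (f s) = l s + k (f s)" if "s \<in> S" for s
    using that l[of s] g2[of s] by (simp add: k_def)
  have "\<exists>L\<ge>0. \<forall>s\<in>S. \<bar>l s\<bar> \<le> L * 1"
    by (rule finite_domination[OF assms(1)]) auto
  then obtain L where L: "L \<ge> 0" "\<And>s. s \<in> S \<Longrightarrow> \<bar>l s\<bar> \<le> L" by auto
  have "\<bar>v s - (g s / \<epsilon> + h s + \<epsilon> * k s)\<bar> \<le> 2 * L * \<epsilon>\<^sup>2"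
    if \<epsilon>: "0 < \<epsilon>" "\<epsilon> < 1" and v: "\<And>s. s \<in> S \<Longrightarrow> v s = c s + (1 - \<epsilon>) * v (f s)" and s: "s \<in> S"
    for \<epsilon> :: real and v s
  proof -
    \<comment> \<open>The Poisson equations cancel all orders below the third in the recursion for
      \<open>e\<close>. Its contraction factor \<open>1 - \<epsilon>\<close> costs one power of
      \<open>\<epsilon>\<close>, which leaves the second.\<close>
    define e where "e s = v s - (g s / \<epsilon> + h s + \<epsilon> * k s + \<epsilon>\<^sup>2 * l s)" for s
    have e_rec: "e s = (1 - \<epsilon>) * e (f s) - \<epsilon> ^ 3 * l (f s)" if "s \<in> S" for s
      using \<epsilon>(1) unfolding e_def v[OF that] g[OF that] l[OF that] k[OF that] h[OF that]
      by (simp add: field_simps power2_eq_square power3_eq_cube)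
    define m where "m = Max ((\<lambda>s. \<bar>e s\<bar>) ` S)"
    have e_le: "\<bar>e s\<bar> \<le> m" if "s \<in> S" for s
      using that assms(1) by (auto simp: m_def)
    have "m \<in> (\<lambda>s. \<bar>e s\<bar>) ` S" unfolding m_def using assms(1) s by (intro Max_in) auto
    then obtain s' where s': "s' \<in> S" "m = \<bar>e s'\<bar>" by auto
    have "m \<le> \<bar>(1 - \<epsilon>) * e (f s')\<bar> + \<bar>\<epsilon> ^ 3 * l (f s')\<bar>"
      unfolding s'(2) by (subst e_rec[OF s'(1)]) (rule abs_triangle_ineq4)
    also have "\<dots> = (1 - \<epsilon>) * \<bar>e (f s')\<bar> + \<epsilon> ^ 3 * \<bar>l (f s')\<bar>"
      using \<epsilon> by (simp add: abs_mult)
    also have "\<dots> \<le> (1 - \<epsilon>) * m + \<epsilon> ^ 3 * L"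
      using \<epsilon> s'(1) by (intro add_mono mult_left_mono e_le L fS) auto
    finally have "\<epsilon> * m \<le> \<epsilon> * (L * \<epsilon>\<^sup>2)"
      by (simp add: algebra_simps power2_eq_square power3_eq_cube)
    then have "m \<le> L * \<epsilon>\<^sup>2" using \<epsilon>(1) by simp
    then have "\<bar>e s\<bar> \<le> L * \<epsilon>\<^sup>2" using e_le[OF s] by linarith
    moreover have "\<bar>\<epsilon>\<^sup>2 * l s\<bar> \<le> L * \<epsilon>\<^sup>2"
      using mult_right_mono[OF L(2)[OF s], of "\<epsilon>\<^sup>2"] by (simp add: abs_mult mult.commute)
    ultimately show ?thesis unfolding e_def by linarith
  qed
  then show ?thesis by blast
qed

section \<open>From discounted to lexicographic inequalities\<close>

lemma nonneg_by_small_perturbation: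
  fixes a M :: real
  assumes "\<And>\<delta>::real. 0 < \<delta> \<Longrightarrow> \<exists>\<epsilon>\<in>Q. 0 < \<epsilon> \<and> \<epsilon> < \<delta>" "\<And>\<epsilon>. \<epsilon> \<in> Q \<Longrightarrow> 0 \<le> a + \<epsilon> * M"
  shows "0 \<le> a"
proof (rule ccontr)
  assume "\<not> 0 \<le> a"
  then have "0 < - a / (\<bar>M\<bar> + 1)" by (intro divide_pos_pos) auto
  from assms(1)[OF this] obtain \<epsilon> where \<epsilon>: "\<epsilon> \<in> Q" "0 < \<epsilon>" "\<epsilon> < - a / (\<bar>M\<bar> + 1)" by auto
  have "\<epsilon> * (\<bar>M\<bar> + 1) < - a"
    using \<epsilon>(3) by (subst (asm) pos_less_divide_eq) auto
  moreover have "\<epsilon> * M \<le> \<epsilon> * (\<bar>M\<bar> + 1)" using \<epsilon>(2) by (intro mult_left_mono) auto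
  ultimately show False using assms(2)[OF \<epsilon>(1)] by linarith
qed

text \<open>The lowest order with a nonzero coefficient dominates near 0. It is enough that
  \<open>Q\<close> accumulates at 0, which suits a set of rates obtained by a pigeonhole
  argument.\<close>

lemma lex_nonneg_by_small_perturbation:
  fixes a b d M :: real
  assumes Q: "\<And>\<delta>::real. 0 < \<delta> \<Longrightarrow> \<exists>\<epsilon>\<in>Q. 0 < \<epsilon> \<and> \<epsilon> < \<delta>" "Q \<subseteq> {0<..<1}"
    and ineq: "\<And>\<epsilon>. \<epsilon> \<in> Q \<Longrightarrow> 0 \<le> a / \<epsilon> + b + \<epsilon> * d + M * \<epsilon>\<^sup>2"
  shows "0 \<le> a \<and> (a = 0 \<longrightarrow> 0 \<le> b) \<and> (a = 0 \<and> b = 0 \<longrightarrow> 0 \<le> d)"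
proof -
  have Q01: "0 < \<epsilon>" "\<epsilon> < 1" if "\<epsilon> \<in> Q" for \<epsilon> using Q(2) that by auto
  \<comment> \<open>As \<open>\<epsilon> < 1\<close>, every higher order is crudely absorbed into
    the first.\<close>
  have le: "\<epsilon> * x \<le> \<epsilon> * \<bar>x\<bar>" "\<epsilon> * \<epsilon> * x \<le> \<epsilon> * \<bar>x\<bar>" "\<epsilon> * \<epsilon> * \<epsilon> * x \<le> \<epsilon> * \<bar>x\<bar>"
    if "\<epsilon> \<in> Q" for \<epsilon> x :: real
  proof -
    have 1: "y * x \<le> \<epsilon> * \<bar>x\<bar>" if "0 \<le> y" "y \<le> \<epsilon>" for y
      by (rule order_trans[of _ "y * \<bar>x\<bar>"])
        (use that in \<open>auto intro: mult_left_mono mult_right_mono\<close>)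
    have 2: "\<epsilon> * \<epsilon> \<le> \<epsilon>" using Q01[OF that] by (intro mult_left_le) auto
    have 3: "\<epsilon> * \<epsilon> * \<epsilon> \<le> \<epsilon>" using 2 Q01[OF that] by (meson less_imp_le mult_left_le mult_nonneg_nonneg order_trans)
    show "\<epsilon> * x \<le> \<epsilon> * \<bar>x\<bar>" "\<epsilon> * \<epsilon> * x \<le> \<epsilon> * \<bar>x\<bar>" "\<epsilon> * \<epsilon> * \<epsilon> * x \<le> \<epsilon> * \<bar>x\<bar>"
      using Q01[OF that] 2 3 by (intro 1; simp)+
  qed
  have ineq': "0 \<le> a + \<epsilon> * b + \<epsilon> * \<epsilon> * d + \<epsilon> * \<epsilon> * \<epsilon> * M" if "\<epsilon> \<in> Q" for \<epsilon>
    using mult_left_mono[OF ineq[OF that], of \<epsilon>] Q01[OF that]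
    by (simp add: algebra_simps power2_eq_square)
  have "0 \<le> a"
  proof (rule nonneg_by_small_perturbation[OF Q(1)])
    show "0 \<le> a + \<epsilon> * (\<bar>b\<bar> + \<bar>d\<bar> + \<bar>M\<bar>)" if "\<epsilon> \<in> Q" for \<epsilon>
      using ineq'[OF that] le(1)[OF that, of b] le(2)[OF that, of d] le(3)[OF that, of M]
      by (simp add: algebra_simps)
  qed
  moreover have "0 \<le> b" if "a = 0"
  proof (rule nonneg_by_small_perturbation[OF Q(1)])
    show "0 \<le> b + \<epsilon> * (\<bar>d\<bar> + \<bar>M\<bar>)" if "\<epsilon> \<in> Q" for \<epsilon>
      using ineq[OF that] \<open>a = 0\<close> le(1)[OF that, of d] le(2)[OF that, of M]
      by (simp add: algebra_simps power2_eq_square)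
  qed
  moreover have "0 \<le> d" if "a = 0" "b = 0"
  proof (rule nonneg_by_small_perturbation[OF Q(1)])
    show "0 \<le> d + \<epsilon> * M" if "\<epsilon> \<in> Q" for \<epsilon>
    proof -
      have "0 \<le> \<epsilon> * (d + \<epsilon> * M)"
        using ineq[OF that] \<open>a = 0\<close> \<open>b = 0\<close> by (simp add: algebra_simps power2_eq_square)
      then show ?thesis using Q01[OF that] by (simp add: zero_le_mult_iff)
    qed
  qed
  ultimately show ?thesis by blast
qed

lemma lex_step_if_discounted:
  fixes g h k :: "'a \<Rightarrow> real" and v :: "real \<Rightarrow> 'a \<Rightarrow> real"
  assumes Q: "\<And>\<delta>::real. 0 < \<delta> \<Longrightarrow> \<exists>\<epsilon>\<in>Q. 0 < \<epsilon> \<and> \<epsilon> < \<delta>" "Q \<subseteq> {0<..<1}"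
    and s: "\<And>\<epsilon>. \<epsilon> \<in> Q \<Longrightarrow> \<bar>v \<epsilon> s - (g s / \<epsilon> + h s + \<epsilon> * k s)\<bar> \<le> L * \<epsilon>\<^sup>2"
    and t: "\<And>\<epsilon>. \<epsilon> \<in> Q \<Longrightarrow> \<bar>v \<epsilon> t - (g t / \<epsilon> + h t + \<epsilon> * k t)\<bar> \<le> L * \<epsilon>\<^sup>2"
    and ineq: "\<And>\<epsilon>. \<epsilon> \<in> Q \<Longrightarrow> c + (1 - \<epsilon>) * v \<epsilon> t \<le> v \<epsilon> s"
  shows "lex_step g h k c s t"
proof -
  \<comment> \<open>The factor \<open>1 - \<epsilon>\<close> moves \<open>g t\<close>,
    \<open>h t\<close> and \<open>k t\<close> up by one order each. The last of these joins the two
    expansion errors in the coefficient of \<open>\<epsilon>\<^sup>2\<close>.\<close>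
  have "0 \<le> (g s - g t) / \<epsilon> + (h s - (c - g t + h t)) + \<epsilon> * (k s - (k t - h t)) + (2 * L + k t) * \<epsilon>\<^sup>2"
    if "\<epsilon> \<in> Q" for \<epsilon>
  proof -
    have \<epsilon>: "0 < \<epsilon>" "\<epsilon> < 1" using that Q(2) by auto
    define u where "u s = g s / \<epsilon> + h s + \<epsilon> * k s" for s
    have us: "v \<epsilon> s \<le> u s + L * \<epsilon>\<^sup>2" using s[OF that] unfolding u_def by linarith
    have ut: "u t - L * \<epsilon>\<^sup>2 \<le> v \<epsilon> t" using t[OF that] unfolding u_def by linarith
    have "0 \<le> L * \<epsilon>\<^sup>2" using s[OF that] by linarith
    then have "(1 - \<epsilon>) * (L * \<epsilon>\<^sup>2) \<le> L * \<epsilon>\<^sup>2"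
      using \<epsilon> by (intro mult_left_le_one_le) auto
    moreover have "(1 - \<epsilon>) * (u t - L * \<epsilon>\<^sup>2) \<le> (1 - \<epsilon>) * v \<epsilon> t"
      using \<epsilon> ut by (intro mult_left_mono) auto
    ultimately have "0 \<le> u s - c - (1 - \<epsilon>) * u t + 2 * (L * \<epsilon>\<^sup>2)"
      using ineq[OF that] us unfolding right_diff_distrib by linarith
    also have "\<dots> = (g s - g t) / \<epsilon> + (h s - (c - g t + h t)) + \<epsilon> * (k s - (k t - h t)) + (2 * L + k t) * \<epsilon>\<^sup>2"
      using \<epsilon> by (simp add: u_def field_simps power2_eq_square)
    finally show ?thesis .
  qed
  from lex_nonneg_by_small_perturbation[OF Q this] show ?thesis
    by (auto simp: lex_step_def)
qed

text \<open>Restricted to the states there are only finitely many choice functions, so one of them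
  is optimal for infinitely many of the rates \<open>1 / (n + 2)\<close>.\<close>

lemma uniform_discounted_choice:
  fixes G :: "'a game" and c :: "'a \<Rightarrow> 'a \<Rightarrow> real"
  assumes G: "is_game G"
  shows "\<exists>f v Q. (\<forall>\<delta>>0. \<exists>\<epsilon>\<in>Q. 0 < \<epsilon> \<and> \<epsilon> < \<delta>) \<and> Q \<subseteq> {0<..<1::real} \<and>
    (\<forall>\<epsilon>\<in>Q. \<forall>s\<in>states G. (s, f s) \<in> edges G \<and> v \<epsilon> s = c s (f s) + (1 - \<epsilon>) * v \<epsilon> (f s) \<and>
           (\<forall>t. (s, t) \<in> edges G \<longrightarrow>
              (s \<in> states1 G \<longrightarrow> v \<epsilon> s \<le> c s t + (1 - \<epsilon>) * v \<epsilon> t) \<and>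
              (s \<in> states2 G \<longrightarrow> c s t + (1 - \<epsilon>) * v \<epsilon> t \<le> v \<epsilon> s)))"
proof -
  define good where "good \<epsilon> v f \<longleftrightarrow> (\<forall>s\<in>states G. (s, f s) \<in> edges G \<and>
           v s = c s (f s) + (1 - \<epsilon>) * v (f s) \<and>
           (\<forall>t. (s, t) \<in> edges G \<longrightarrow>
              (s \<in> states1 G \<longrightarrow> v s \<le> c s t + (1 - \<epsilon>) * v t) \<and>
              (s \<in> states2 G \<longrightarrow> c s t + (1 - \<epsilon>) * v t \<le> v s)))" for \<epsilon> v f
  have "\<exists>v f. good \<epsilon> v f" if "0 < \<epsilon>" "\<epsilon> < 1" for \<epsilon>
    using discounted_optimality[OF G, of "1 - \<epsilon>" c] that unfolding good_def by auto
  then obtain v f where vf: "\<And>\<epsilon>. 0 < \<epsilon> \<Longrightarrow> \<epsilon> < 1 \<Longrightarrow> good \<epsilon> (v \<epsilon>) (f \<epsilon>)" by metis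
  define E where "E n = 1 / (real n + 2)" for n
  have E: "0 < E n" "E n < 1" for n by (auto simp: E_def)
  define F where "F n = restrict (f (E n)) (states G)" for n
  have f_states: "f (E n) s \<in> states G" if "s \<in> states G" for n s
  proof -
    have "(s, f (E n) s) \<in> edges G" using vf[OF E[of n]] that by (simp add: good_def)
    then show ?thesis using G by (auto simp: is_game_def)
  qed
  have "finite (states G)" using G by (auto simp: is_game_def states_def)
  moreover have "range F \<subseteq> states G \<rightarrow>\<^sub>E states G"
    using f_states by (auto simp: F_def)
  ultimately have "finite (range F)" by (meson finite_PiE finite_subset)
  then obtain n0 where n0: "infinite {n. F n = F n0}"
    using pigeonhole_infinite[of UNIV F] by auto
  define Q where "Q = E ` {n. F n = F n0}"
  have "\<exists>\<epsilon>\<in>Q. 0 < \<epsilon> \<and> \<epsilon> < \<delta>" if \<delta>: "0 < \<delta>" for \<delta>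
  proof -
    obtain m :: nat where m: "1 / \<delta> < real m" using reals_Archimedean2 by blast
    obtain n where n: "n > m" "F n = F n0" 
      using n0 unfolding infinite_nat_iff_unbounded by auto
    have "1 / \<delta> < real n + 2" using m n(1) by linarith
    then have "E n < \<delta>" using \<delta> by (simp add: E_def field_simps)
    then show ?thesis using n E unfolding Q_def by blast
  qed
  moreover have "good \<epsilon> (v \<epsilon>) (F n0)" if "\<epsilon> \<in> Q" for \<epsilon>
  proof -
    obtain n where n: "\<epsilon> = E n" "F n = F n0" using \<open>\<epsilon> \<in> Q\<close> by (auto simp: Q_def)
    have "good (E n) (v (E n)) (F n) \<longleftrightarrow> good (E n) (v (E n)) (f (E n))"
      unfolding good_def F_def by (intro ball_cong) simp_all
    then have "good (E n) (v (E n)) (F n)" using vf[OF E[of n]] by blast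
    then show ?thesis unfolding n .
  qed
  moreover have "Q \<subseteq> {0<..<1}" using E by (auto simp: Q_def)
  ultimately have "(\<forall>\<delta>>0. \<exists>\<epsilon>\<in>Q. 0 < \<epsilon> \<and> \<epsilon> < \<delta>) \<and> Q \<subseteq> {0<..<1} \<and>
      (\<forall>\<epsilon>\<in>Q. good \<epsilon> (v \<epsilon>) (F n0))"
    by blast
  then show ?thesis unfolding good_def by (intro exI)
qed

text \<open>Both directions come from the same expansion: exchanging the players negates costs and
  values, and with them \<open>g\<close>, \<open>h\<close> and \<open>k\<close>. Along
  \<open>f\<close> both hold, because the optimality inequality is an equality there.\<close>

lemma lexicographic_optimality:
  fixes G :: "'a game" and c :: "'a \<Rightarrow> 'a \<Rightarrow> real"
  assumes G: "is_game G"
  shows "\<exists>f g h k. \<forall>s\<in>states G. (s, f s) \<in> edges G \<and>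
    (\<forall>t. (s, t) \<in> edges G \<longrightarrow>
      (s \<in> states2 G \<or> t = f s \<longrightarrow> lex_step g h k (c s t) s t) \<and>
      (s \<in> states1 G \<or> t = f s \<longrightarrow>
        lex_step (\<lambda>s. - g s) (\<lambda>s. - h s) (\<lambda>s. - k s) (- c s t) s t))"
proof -
  obtain f and v :: "real \<Rightarrow> 'a \<Rightarrow> real" and Q where
    Q: "\<And>\<delta>. \<delta> > 0 \<Longrightarrow> \<exists>\<epsilon>\<in>Q. 0 < \<epsilon> \<and> \<epsilon> < \<delta>" "Q \<subseteq> {0<..<1::real}"
    and v: "\<And>\<epsilon> s. \<epsilon> \<in> Q \<Longrightarrow> s \<in> states G \<Longrightarrow>
           (s, f s) \<in> edges G \<and> v \<epsilon> s = c s (f s) + (1 - \<epsilon>) * v \<epsilon> (f s) \<and>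
           (\<forall>t. (s, t) \<in> edges G \<longrightarrow>
              (s \<in> states1 G \<longrightarrow> v \<epsilon> s \<le> c s t + (1 - \<epsilon>) * v \<epsilon> t) \<and>
              (s \<in> states2 G \<longrightarrow> c s t + (1 - \<epsilon>) * v \<epsilon> t \<le> v \<epsilon> s))"
    using uniform_discounted_choice[OF G, of c] by (elim exE conjE) blast
  have edge_states: "t \<in> states G" if "(s, t) \<in> edges G" for s t
    using G that by (auto simp: is_game_def)
  \<comment> \<open>The edge property of \<open>f\<close> is available only through a rate in
    \<open>Q\<close>, so one such rate is needed.\<close>
  obtain \<epsilon>0 where "\<epsilon>0 \<in> Q" using Q(1)[of 1] by auto
  then have f: "(s, f s) \<in> edges G" if "s \<in> states G" for s using v that by blast
  have "finite (states G)" "f ` states G \<subseteq> states G"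
    using G f edge_states by (auto simp: is_game_def states_def)
  from discounted_expansion[OF this, of "\<lambda>s. c s (f s)"] obtain g h k L where
    exp: "\<And>\<epsilon> v s. 0 < \<epsilon> \<Longrightarrow> \<epsilon> < 1 \<Longrightarrow> (\<And>s. s \<in> states G \<Longrightarrow> v s = c s (f s) + (1 - \<epsilon>) * v (f s)) \<Longrightarrow>
           s \<in> states G \<Longrightarrow> \<bar>v s - (g s / \<epsilon> + h s + \<epsilon> * k s)\<bar> \<le> L * \<epsilon>\<^sup>2"
    by blast
  have vexp: "\<bar>v \<epsilon> s - (g s / \<epsilon> + h s + \<epsilon> * k s)\<bar> \<le> L * \<epsilon>\<^sup>2" if "\<epsilon> \<in> Q" "s \<in> states G" for \<epsilon> s
    by (rule exp) (use that Q(2) v in auto)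
  have vexp': "\<bar>- v \<epsilon> s - (- g s / \<epsilon> + - h s + \<epsilon> * - k s)\<bar> \<le> L * \<epsilon>\<^sup>2"
    if "\<epsilon> \<in> Q" "s \<in> states G" for \<epsilon> s
  proof -
    have "- v \<epsilon> s - (- g s / \<epsilon> + - h s + \<epsilon> * - k s) = - (v \<epsilon> s - (g s / \<epsilon> + h s + \<epsilon> * k s))"
      by simp
    then show ?thesis using vexp[OF that] by (simp only: abs_minus_cancel)
  qed
  have "lex_step g h k (c s t) s t"
    if "s \<in> states G" "(s, t) \<in> edges G" "s \<in> states2 G \<or> t = f s" for s t
  proof (rule lex_step_if_discounted[where v = v and Q = Q and L = L])
    show "c s t + (1 - \<epsilon>) * v \<epsilon> t \<le> v \<epsilon> s" if "\<epsilon> \<in> Q" for \<epsilon>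
      using v[OF that, of s] \<open>s \<in> states G\<close> \<open>(s, t) \<in> edges G\<close> \<open>s \<in> states2 G \<or> t = f s\<close>
      by auto
  qed (use that(1) edge_states[OF that(2)] Q vexp in auto)
  moreover have "lex_step (\<lambda>s. - g s) (\<lambda>s. - h s) (\<lambda>s. - k s) (- c s t) s t"
    if "s \<in> states G" "(s, t) \<in> edges G" "s \<in> states1 G \<or> t = f s" for s t
  proof (rule lex_step_if_discounted[where v = "\<lambda>\<epsilon> s. - v \<epsilon> s" and Q = Q and L = L])
    show "- c s t + (1 - \<epsilon>) * - v \<epsilon> t \<le> - v \<epsilon> s" if "\<epsilon> \<in> Q" for \<epsilon>
      using v[OF that, of s] \<open>s \<in> states G\<close> \<open>(s, t) \<in> edges G\<close> \<open>s \<in> states1 G \<or> t = f s\<close>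
      by auto
  qed (use that(1) edge_states[OF that(2)] Q vexp' in auto)
  ultimately show ?thesis using f by blast
qed

section \<open>Values and memoryless optimal strategies\<close>

text \<open>The same \<open>v\<close> bounds the limit superior from above and the limit inferior
  from below, so one pair of strategies settles both variants, uniformly in the initial
  state.\<close>

theorem average_energy_values:
  fixes G :: "'a game"
  assumes G: "is_game G"
  shows "\<exists>(v :: 'a \<Rightarrow> ereal) \<sigma>1 \<sigma>2.
    memoryless_strategy G Player1 \<sigma>1 \<and> memoryless_strategy G Player2 \<sigma>2 \<and>
    (\<forall>s\<in>states G. (\<forall>\<pi>\<in>consistent_plays G s Player1 \<sigma>1. AE_sup G \<pi> \<le> v s) \<and>
                   (\<forall>\<pi>\<in>consistent_plays G s Player2 \<sigma>2. v s \<le> AE_inf G \<pi>))"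
proof -
  define c where "c s t = real_of_int (weight G (s, t))" for s t
  obtain f g h k where f: "\<And>s. s \<in> states G \<Longrightarrow> (s, f s) \<in> edges G"
    and lex1: "\<And>s t. s \<in> states G \<Longrightarrow> (s, t) \<in> edges G \<Longrightarrow> s \<in> states2 G \<or> t = f s \<Longrightarrow>
        lex_step g h k (c s t) s t"
    and lex2: "\<And>s t. s \<in> states G \<Longrightarrow> (s, t) \<in> edges G \<Longrightarrow> s \<in> states1 G \<or> t = f s \<Longrightarrow>
        lex_step (\<lambda>s. - g s) (\<lambda>s. - h s) (\<lambda>s. - k s) (- c s t) s t"
    using lexicographic_optimality[OF G, of c] by blast
  have finE: "finite (edges G)"
    using G by (auto simp: is_game_def states_def intro: finite_subset)
  have edge_states: "s \<in> states G" if "(s, t) \<in> edges G" for s t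
    using G that by (auto simp: is_game_def)
  \<comment> \<open>One map serves both players, since \<open>f\<close> selects a successor at every
    state.\<close>
  define \<sigma> where "\<sigma> \<rho> = f (last \<rho>)" for \<rho>
  define v where "v s = (if g s = 0 then ereal (h s) else if g s < 0 then -\<infinity> else \<infinity>)" for s
  have mem: "memoryless_strategy G p \<sigma>" for p
  proof -
    have "owned G p \<subseteq> states G" by (cases p) (auto simp: states_def)
    then show ?thesis
      using f by (auto simp: memoryless_strategy_def memoryless_def is_strategy_def \<sigma>_def prefixes_def)
  qed
  have last: "last (play_prefix \<pi> n) = \<pi> n" for \<pi> :: "nat \<Rightarrow> 'a" and n
    by (simp add: play_prefix_def)
  have mean: "mean_energy G \<pi> n = 1 / real n * (\<Sum>i=1..n. \<Sum>j<i. c (\<pi> j) (\<pi> (Suc j)))" for \<pi> n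
    by (simp add: mean_energy_def energy_level_def c_def)
  have 1: "AE_sup G \<pi> \<le> v s" if \<pi>: "\<pi> \<in> consistent_plays G s Player1 \<sigma>" for s \<pi>
  proof -
    \<comment> \<open>These are the edges left once player 1 follows \<open>f\<close>; all of them
      satisfy the inequalities that bound the average from above.\<close>
    define E where "E = {(s, t) \<in> edges G. s \<in> states2 G \<or> t = f s}"
    have step: "(\<pi> i, \<pi> (Suc i)) \<in> E" for i
      using \<pi> edge_states[of "\<pi> i" "\<pi> (Suc i)"]
      by (auto simp: E_def consistent_plays_def plays_from_def \<sigma>_def last states_def)
    have "finite E" using finE by (rule finite_subset[rotated]) (auto simp: E_def)
    from lex_step_limsup[of E g h k c \<pi>, OF this _ step] show ?thesis
      using lex1 edge_states \<pi>
      by (auto simp: E_def AE_sup_def mean v_def consistent_plays_def plays_from_def)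
  qed
  have 2: "v s \<le> AE_inf G \<pi>" if \<pi>: "\<pi> \<in> consistent_plays G s Player2 \<sigma>" for s \<pi>
  proof -
    define E where "E = {(s, t) \<in> edges G. s \<in> states1 G \<or> t = f s}"
    have step: "(\<pi> i, \<pi> (Suc i)) \<in> E" for i
      using \<pi> edge_states[of "\<pi> i" "\<pi> (Suc i)"]
      by (auto simp: E_def consistent_plays_def plays_from_def \<sigma>_def last states_def)
    have "finite E" using finE by (rule finite_subset[rotated]) (auto simp: E_def)
    \<comment> \<open>Negating all data turns the limit inferior into a limit superior, so the upper
      bound applies again.\<close>
    have "limsup (\<lambda>n. - ereal (mean_energy G \<pi> n)) \<le> - v s"
      using lex_step_limsup[of E "\<lambda>s. - g s" "\<lambda>s. - h s" "\<lambda>s. - k s" "\<lambda>s t. - c s t" \<pi>,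
          OF \<open>finite E\<close> _ step] lex2 edge_states \<pi>
      by (auto simp: E_def mean v_def consistent_plays_def plays_from_def sum_negf)
    then show ?thesis
      unfolding ereal_Limsup_uminus AE_inf_def by (simp only: ereal_minus_le_minus)
  qed
  show ?thesis using mem 1 2 by blast
qed

text \<open>As the limit inferior is at most the limit superior, the two bounds by
  \<open>v s_init\<close> carry over to both averages. Comparing this value with \<open>t\<close>
  then decides the winner.\<close>

theorem theorem3:
  fixes G :: "'a game" and s_init :: 'a
  assumes "is_game G" and "s_init \<in> states G"
  shows
    "(\<exists>(v::ereal) \<sigma>1 \<sigma>2.
        memoryless_strategy G Player1 \<sigma>1 \<and> memoryless_strategy G Player2 \<sigma>2 \<and>
        (\<forall>\<pi>\<in>consistent_plays G s_init Player1 \<sigma>1. AE_sup G \<pi> \<le> v) \<and>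
        (\<forall>\<pi>\<in>consistent_plays G s_init Player2 \<sigma>2. AE_sup G \<pi> \<ge> v)) \<and>
     (\<forall>t::rat.
        (\<exists>\<sigma>1. memoryless_strategy G Player1 \<sigma>1 \<and>
              wins_with G s_init Player1 \<sigma>1 (AvgEnergy_sup G t)) \<or>
        (\<exists>\<sigma>2. memoryless_strategy G Player2 \<sigma>2 \<and>
              wins_with G s_init Player2 \<sigma>2 (AvgEnergy_sup G t))) \<and>
     (\<exists>(v::ereal) \<sigma>1 \<sigma>2.
        memoryless_strategy G Player1 \<sigma>1 \<and> memoryless_strategy G Player2 \<sigma>2 \<and>
        (\<forall>\<pi>\<in>consistent_plays G s_init Player1 \<sigma>1. AE_inf G \<pi> \<le> v) \<and>
        (\<forall>\<pi>\<in>consistent_plays G s_init Player2 \<sigma>2. AE_inf G \<pi> \<ge> v)) \<and>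
     (\<forall>t::rat.
        (\<exists>\<sigma>1. memoryless_strategy G Player1 \<sigma>1 \<and>
              wins_with G s_init Player1 \<sigma>1 (AvgEnergy_inf G t)) \<or>
        (\<exists>\<sigma>2. memoryless_strategy G Player2 \<sigma>2 \<and>
              wins_with G s_init Player2 \<sigma>2 (AvgEnergy_inf G t)))"
proof -
  obtain v \<sigma>1 \<sigma>2 where mem: "memoryless_strategy G Player1 \<sigma>1" "memoryless_strategy G Player2 \<sigma>2"
    and sup1: "\<And>\<pi>. \<pi> \<in> consistent_plays G s_init Player1 \<sigma>1 \<Longrightarrow> AE_sup G \<pi> \<le> v s_init"
    and inf2: "\<And>\<pi>. \<pi> \<in> consistent_plays G s_init Player2 \<sigma>2 \<Longrightarrow> v s_init \<le> AE_inf G \<pi>"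
    using average_energy_values[OF assms(1)] assms(2) by blast
  have le: "AE_inf G \<pi> \<le> AE_sup G \<pi>" for \<pi>
    by (simp add: AE_inf_def AE_sup_def Liminf_le_Limsup)
  have inf1: "AE_inf G \<pi> \<le> v s_init" if "\<pi> \<in> consistent_plays G s_init Player1 \<sigma>1" for \<pi>
    using le sup1[OF that] by (rule order_trans)
  have sup2: "v s_init \<le> AE_sup G \<pi>" if "\<pi> \<in> consistent_plays G s_init Player2 \<sigma>2" for \<pi>
    using inf2[OF that] le by (rule order_trans)
  \<comment> \<open>The objectives contain only plays starting in a state, so membership has to be
    shown for player 1 to win.\<close>
  have plays: "\<pi> \<in> plays G" if "\<pi> \<in> consistent_plays G s_init p \<sigma>" for \<pi> p \<sigma>
    using that assms(2) by (auto simp: consistent_plays_def plays_def)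
  have win: "wins_with G s_init Player1 \<sigma>1 (AvgEnergy_sup G t) \<and>
      wins_with G s_init Player1 \<sigma>1 (AvgEnergy_inf G t)" if "v s_init \<le> ereal (of_rat t)" for t
    using that sup1 inf1 plays by (auto simp: AvgEnergy_sup_def AvgEnergy_inf_def intro: order_trans)
  have lose: "wins_with G s_init Player2 \<sigma>2 (AvgEnergy_sup G t) \<and>
      wins_with G s_init Player2 \<sigma>2 (AvgEnergy_inf G t)" if "\<not> v s_init \<le> ereal (of_rat t)" for t
    using that sup2 inf2 by (auto simp: AvgEnergy_sup_def AvgEnergy_inf_def dest: order_trans)
  show ?thesis
    using mem sup1 sup2 inf1 inf2 win lose by blast
qed

end
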